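(* Let $t_0<\tau_0\le+\infty$ and let $a,b,c,d,a_1,b_1,c_1,d_1$ be real-valued continuous functions on $[t_0,\tau_0)$. Let $y_1(t)$ be a solution on $[t_0,\tau_0)$ of $$y'+a_1(t)y^3+b_1(t)y^2+c_1(t)y+d_1(t)=0,$$ and let $\eta(t)$ be a solution on $[t_0,\tau_0)$ of the differential inequality $$\eta'+a(t)\eta^3+b(t)\eta^2+c(t)\eta+d(t)\ge 0$$ with $\eta(t_0)\ge y_1(t_0)$. Assume: (I) $a(t)<0$ almost everywhere on $[t_0,\tau_0)$, and the function $\frac{b^2(t)}{a(t)}$ is locally integrable on $[t_0,\tau_0)$; (II) for some $\gamma\in[y_1(t_0),\eta(t_0)]$, $$\gamma-y_1(t_0)+\int_{t_0}^{t}\exp\Big\{\int_{t_0}^{\tau}\Big[c(s)-\frac{b^2(s)}{a(s)}\Big]ds\Big\}\Big[(a_1(\tau)-a(\tau))y_1^3(\tau)+(b_1(\tau)-b(\tau))y_1^2(\tau)+(c_1(\tau)-c(\tau))y_1(\tau)+d_1(\tau)-d(\tau)\Big]d\tau\ge 0$$ for all $t\in[t_0,\tau_0)$. Then every solution $y(t)$ of $$y'+a(t)y^3+b(t)y^2+c(t)y+d(t)=0$$ with $y(t_0)\in[\gamma,\eta(t_0)]$ exists on $[t_0,\tau_0)$ and $$y_1(t)\le y(t)\le\eta(t),\qquad t_0\le t<\tau_0.$$ Furthermore, if $y_1(t_0)<y(t_0)$, then $y_1(t)<y(t)$ for all $t\in[t_0,\tau_0)$; and if $y(t_0)<\eta(t_0)$,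 then $y(t)<\eta(t)$ for all $t\in[t_0,\tau_0)$.
   Context: All functions are real-valued. A solution of a differential equation or differential inequality on an interval is a differentiable function satisfying it at every point of the interval (one-sided derivative at an included endpoint). "A solution $y$ of the equation exists on $[t_0,\tau_0)$" means that the solution of the initial value problem with the given value at $t_0$ is defined on all of $[t_0,\tau_0)$. "Locally integrable on $[t_0,\tau_0)$" means Lebesgue integrable on $[t_0,t_1]$ for every $t_1\in(t_0,\tau_0)$. *)

theory Defs
  imports "HOL-Analysis.Analysis"
begin

text \<open>The right end point is an extended real, so that it may be infinite.\<close>

definition half_open :: "real \<Rightarrow> ereal \<Rightarrow> real set" where
  "half_open t0 \<tau> = {t. t0 \<le> t \<and> ereal t < \<tau>}"

text \<open>The derivative is taken within \<open>J\<close>: on \<open>J = half_open t0 \<tau>\<close> it is the right derivative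
  at \<open>t0\<close> and the ordinary derivative at every other point.\<close>

definition cubic_ode_solution ::
  "(real \<Rightarrow> real) \<Rightarrow> (real \<Rightarrow> real) \<Rightarrow> (real \<Rightarrow> real) \<Rightarrow> (real \<Rightarrow> real) \<Rightarrow> real set \<Rightarrow> (real \<Rightarrow> real) \<Rightarrow> bool"
  where
  "cubic_ode_solution a b c d J y \<longleftrightarrow>
     (\<forall>t\<in>J. \<exists>D. (y has_real_derivative D) (at t within J) \<and>
        D + a t * y t ^ 3 + b t * y t ^ 2 + c t * y t + d t = 0)"

definition cubic_supersolution ::
  "(real \<Rightarrow> real) \<Rightarrow> (real \<Rightarrow> real) \<Rightarrow> (real \<Rightarrow> real) \<Rightarrow> (real \<Rightarrow> real) \<Rightarrow> real set \<Rightarrow> (real \<Rightarrow> real) \<Rightarrow> bool"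
  where
  "cubic_supersolution a b c d J \<eta> \<longleftrightarrow>
     (\<forall>t\<in>J. \<exists>D. (\<eta> has_real_derivative D) (at t within J) \<and>
        D + a t * \<eta> t ^ 3 + b t * \<eta> t ^ 2 + c t * \<eta> t + d t \<ge> 0)"

text \<open>Global existence for the initial value problem \<open>y t0 = y0\<close>: there is a solution on the whole
  of \<open>half_open t0 \<tau>0\<close>, and every solution given only on an initial piece \<open>half_open t0 \<tau>\<close> continues
  to one on the whole of \<open>half_open t0 \<tau>0\<close>.\<close>

definition cubic_ivp_exists_on ::
  "(real \<Rightarrow> real) \<Rightarrow> (real \<Rightarrow> real) \<Rightarrow> (real \<Rightarrow> real) \<Rightarrow> (real \<Rightarrow> real) \<Rightarrow> real \<Rightarrow> ereal \<Rightarrow> real \<Rightarrow> bool"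
  where
  "cubic_ivp_exists_on a b c d t0 \<tau>0 y0 \<longleftrightarrow>
     (\<exists>y. cubic_ode_solution a b c d (half_open t0 \<tau>0) y \<and> y t0 = y0) \<and>
     (\<forall>\<tau> y. ereal t0 < \<tau> \<and> \<tau> \<le> \<tau>0 \<and> cubic_ode_solution a b c d (half_open t0 \<tau>) y \<and> y t0 = y0 \<longrightarrow>
        (\<exists>z. cubic_ode_solution a b c d (half_open t0 \<tau>0) z \<and> (\<forall>t\<in>half_open t0 \<tau>. z t = y t)))"

definition locally_integrable_on :: "(real \<Rightarrow> real) \<Rightarrow> real \<Rightarrow> ereal \<Rightarrow> bool" where
  "locally_integrable_on f t0 \<tau>0 \<longleftrightarrow>
     (\<forall>t1. t0 < t1 \<and> ereal t1 < \<tau>0 \<longrightarrow> set_integrable lebesgue {t0..t1} f)"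

end

theory Submission
  imports Defs
begin

text \<open>
  Let \<open>y\<close> satisfy the differential inequality and let \<open>z = y1\<close>. The difference \<open>u = y - z\<close> obeys the
  linear inequality \<open>u' + G u \<ge> h\<close> with \<open>G = a (y\<^sup>2 + y z + z\<^sup>2) + b (y + z) + c\<close>, and with
  \<open>h\<close> the bracket of hypothesis (II). If \<open>exp (\<integral>G)\<close> were the weight in (II), an integrating factor
  would give \<open>u \<ge> 0\<close> at once. The weight there is instead \<open>exp (\<integral>q)\<close> with
  \<open>q = c - b\<^sup>2 / a\<close>, which involves the coefficients alone. Completing squares shows that \<open>G \<le> q\<close>
  wherever \<open>a < 0\<close> (\<open>cubic_quotient_le\<close>), so that \<open>exp (\<integral>G) = m exp (\<integral>q)\<close> with \<open>m\<close> positive and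
  nonincreasing. By the second mean value theorem for integrals, nonnegativity of all the partial
  integrals in (II) survives multiplication of the integrand by \<open>m\<close> (\<open>weighted_comparison\<close>).

  This proves that \<open>y1 \<le> y\<close> for every such \<open>y\<close> with \<open>y t0 \<ge> \<gamma>\<close>. Against \<open>\<eta>\<close> the same computation
  applies with \<open>h = 0\<close>, where the plain integrating factor suffices
  (\<open>cubic_supersolution_ge_solution\<close>); it also yields uniqueness.

  Existence follows from these a priori bounds. On a compact interval the cubic is truncated
  outside a band \<open>[-M, M]\<close> that strictly contains the graphs of \<open>y1\<close> and \<open>\<eta>\<close>. The truncated
  equation is globally Lipschitz and hence has a solution (\<open>picard_lindelof_lipschitz\<close>). Until that
  solution leaves the band it solves the original equation, so it stays between \<open>y1\<close> and \<open>\<eta>\<close> and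
  never gets out (\<open>cubic_ivp_exists_if_bounded\<close>). By uniqueness the solutions on the compact intervals
  fit together.
\<close>

section \<open>Linear differential inequalities\<close>

lemma nondecreasing_if_deriv_nonneg:
  fixes f :: "real \<Rightarrow> real"
  assumes der: "\<And>x. x \<in> {a..b} \<Longrightarrow> \<exists>D\<ge>0. (f has_real_derivative D) (at x within {a..b})"
    and st: "a \<le> s" "s \<le> t" "t \<le> b"
  shows "f s \<le> f t"
proof (rule DERIV_nonneg_imp_increasing_open[OF \<open>s \<le> t\<close>])
  fix x assume "s < x" "x < t"
  with der[of x] st show "\<exists>D. DERIV f x :> D \<and> 0 \<le> D"
    by (metis at_within_Icc_at atLeastAtMost_iff le_less_trans less_imp_le less_le_trans)
next
  have "continuous_on {a..b} f"
    using der by (meson DERIV_continuous continuous_on_eq_continuous_within)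
  then show "continuous_on {s..t} f"
    by (rule continuous_on_subset) (use st in auto)
qed

text \<open>
  Multiplied by \<open>exp (\<integral>G)\<close>, the inequality \<open>u' + G u \<ge> h\<close> says that the derivative of
  \<open>u exp (\<integral>G) - \<integral> exp (\<integral>G) h\<close> is nonnegative.
\<close>

lemma integrating_factor_increment:
  fixes u G h :: "real \<Rightarrow> real"
  assumes G: "continuous_on {a..b} G" and h: "continuous_on {a..b} h"
    and u: "\<And>x. x \<in> {a..b} \<Longrightarrow>
      \<exists>D. (u has_real_derivative D) (at x within {a..b}) \<and> D + G x * u x \<ge> h x"
    and st: "a \<le> s" "s \<le> t" "t \<le> b"
  shows "u s * exp (integral {a..s} G) + integral {s..t} (\<lambda>x. exp (integral {a..x} G) * h x)
    \<le> u t * exp (integral {a..t} G)"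
proof -
  let ?\<Gamma> = "\<lambda>x. integral {a..x} G"
  let ?k = "\<lambda>x. exp (?\<Gamma> x) * h x"
  have k: "continuous_on {a..b} ?k"
    by (intro continuous_intros indefinite_integral_continuous_1 integrable_continuous_real G h)
  have "u s * exp (?\<Gamma> s) - integral {a..s} ?k \<le> u t * exp (?\<Gamma> t) - integral {a..t} ?k"
  proof (rule nondecreasing_if_deriv_nonneg[OF _ st])
    fix x assume x: "x \<in> {a..b}"
    obtain D where D: "(u has_real_derivative D) (at x within {a..b})" "D + G x * u x \<ge> h x"
      using u[OF x] by blast
    have "((\<lambda>x. u x * exp (?\<Gamma> x) - integral {a..x} ?k) has_real_derivative
        (D + G x * u x - h x) * exp (?\<Gamma> x)) (at x within {a..b})"
      by (rule derivative_eq_intros D integral_has_real_derivative[OF G x]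
          integral_has_real_derivative[OF k x] refl)+ (simp add: algebra_simps)
    then show "\<exists>E\<ge>0. ((\<lambda>x. u x * exp (?\<Gamma> x) - integral {a..x} ?k) has_real_derivative E)
        (at x within {a..b})"
      using D(2) by (intro exI[of _ "(D + G x * u x - h x) * exp (?\<Gamma> x)"]) simp
  qed
  moreover have "integral {a..s} ?k + integral {s..t} ?k = integral {a..t} ?k"
    by (rule Henstock_Kurzweil_Integration.integral_combine)
       (use st continuous_on_subset[OF k] in \<open>auto intro!: integrable_continuous_real\<close>)
  ultimately show ?thesis by linarith
qed

text \<open>
  With \<open>m = exp (\<integral>(G - q))\<close> and \<open>H t = \<gamma> + \<integral> exp (\<integral>q) h\<close>, the function
  \<open>V = u exp (\<integral>G) - m H\<close> is nondecreasing: formally \<open>V' \<ge> - m' H\<close>, where \<open>m' \<le> 0\<close> and \<open>H \<ge> 0\<close>.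
  Since \<open>q\<close> is merely integrable, \<open>m\<close> need not be differentiable, and the second mean value theorem
  replaces this integration by parts. As \<open>V a = u a - \<gamma> \<ge> 0\<close> and \<open>m H \<ge> 0\<close>, also \<open>u \<ge> 0\<close>. The
  condition \<open>\<integral>G < \<integral>q\<close> for the strict version makes \<open>m\<close> drop immediately; this is what counts
  when \<open>u a = \<gamma>\<close> and \<open>H\<close> returns to \<open>0\<close> later.
\<close>

lemma weighted_comparison:
  fixes u G h q :: "real \<Rightarrow> real"
  assumes G: "continuous_on {a..b} G" and h: "continuous_on {a..b} h"
    and u: "\<And>x. x \<in> {a..b} \<Longrightarrow>
      \<exists>D. (u has_real_derivative D) (at x within {a..b}) \<and> D + G x * u x \<ge> h x"
    and q: "set_integrable lebesgue {a..b} q"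
    and Gq: "AE x \<in> {a..b} in lebesgue. G x \<le> q x"
    and H0: "\<And>t. t \<in> {a..b} \<Longrightarrow>
      0 \<le> \<gamma> + integral {a..t} (\<lambda>x. exp (integral {a..x} q) * h x)"
    and ua: "\<gamma> \<le> u a"
    and t: "t \<in> {a..b}"
  shows weighted_comparison_nonneg: "0 \<le> u t"
    and weighted_comparison_pos: "0 < u a \<Longrightarrow>
      (\<And>s. a < s \<Longrightarrow> s \<le> b \<Longrightarrow> integral {a..s} G < integral {a..s} q) \<Longrightarrow> 0 < u t"
proof -
  define \<Gamma> where "\<Gamma> x = integral {a..x} G" for x
  define Q where "Q x = integral {a..x} q" for x
  define m where "m x = exp (\<Gamma> x - Q x)" for x
  define \<phi> where "\<phi> x = exp (Q x) * h x" for x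
  define H where "H x = \<gamma> + integral {a..x} \<phi>" for x
  define V where "V x = u x * exp (\<Gamma> x) - m x * H x" for x
  have qi: "q integrable_on {a..b}"
    using q set_lebesgue_integral_eq_integral(1) by blast
  have Gi: "G integrable_on {a..b}"
    using G by (rule integrable_continuous_real)
  have \<phi>c: "continuous_on {a..b} \<phi>"
    unfolding \<phi>_def Q_def
    by (intro continuous_intros indefinite_integral_continuous_1 qi h)
  have \<phi>i: "\<phi> integrable_on {a..b}"
    using \<phi>c by (rule integrable_continuous_real)
  have H_nonneg: "0 \<le> H x" if "x \<in> {a..b}" for x
    using H0[OF that] unfolding H_def \<phi>_def Q_def .
  have m_pos: "0 < m x" for x
    by (simp add: m_def)
  have m_antimono: "m y \<le> m x" if "a \<le> x" "x \<le> y" "y \<le> b" for x y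
  proof -
    have sub: "{x..y} \<subseteq> {a..b}" using that by auto
    have qxy: "set_integrable lebesgue {x..y} q"
      by (rule set_integrable_subset[OF q _ sub]) simp
    have Gxy: "set_integrable lebesgue {x..y} G"
      by (rule absolutely_integrable_continuous_real[OF continuous_on_subset[OF G sub]])
    have "(LINT s:{x..y}|lebesgue. G s) \<le> (LINT s:{x..y}|lebesgue. q s)"
      by (rule set_integral_mono_AE[OF Gxy qxy]) (use Gq sub in \<open>auto elim!: AE_mp\<close>)
    then have "integral {x..y} G \<le> integral {x..y} q"
      using set_lebesgue_integral_eq_integral(2)[OF qxy] set_lebesgue_integral_eq_integral(2)[OF Gxy]
      by simp
    moreover have "integral {a..x} G + integral {x..y} G = integral {a..y} G"
      by (rule Henstock_Kurzweil_Integration.integral_combine)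
         (use that integrable_on_subinterval[OF Gi] in auto)
    moreover have "integral {a..x} q + integral {x..y} q = integral {a..y} q"
      by (rule Henstock_Kurzweil_Integration.integral_combine)
         (use that integrable_on_subinterval[OF qi] in auto)
    ultimately show ?thesis by (simp add: m_def \<Gamma>_def Q_def)
  qed
  have V_step: "\<exists>c\<in>{x..y}. (m x - m y) * H c \<le> V y - V x" if xy: "a \<le> x" "x \<le> y" "y \<le> b" for x y
  proof -
    have \<phi>xy: "\<phi> integrable_on {x..y}"
      by (rule integrable_on_subinterval[OF \<phi>i]) (use xy in auto)
    \<comment> \<open>The second mean value theorem is stated for nondecreasing weights, hence the sign of \<open>- m\<close>.\<close>
    obtain c where c: "c \<in> {x..y}"
      and eq: "integral {x..y} (\<lambda>s. - m s * \<phi> s)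
        = - m x * integral {x..c} \<phi> + - m y * integral {c..y} \<phi>"
      by (rule second_mean_value_theorem[OF \<phi>xy \<open>x \<le> y\<close>, of "\<lambda>s. - m s"])
         (use m_antimono xy in auto)
    have H_diff: "integral {r..s} \<phi> = H s - H r" if "a \<le> r" "r \<le> s" "s \<le> b" for r s
    proof -
      have "integral {a..r} \<phi> + integral {r..s} \<phi> = integral {a..s} \<phi>"
        by (rule Henstock_Kurzweil_Integration.integral_combine)
           (use that integrable_on_subinterval[OF \<phi>i] in auto)
      then show ?thesis by (simp add: H_def)
    qed
    have "(\<lambda>s. - m s * \<phi> s) = (\<lambda>s. - (exp (\<Gamma> s) * h s))"
      by (rule ext) (simp add: m_def \<phi>_def exp_diff)
    then have "integral {x..y} (\<lambda>s. exp (\<Gamma> s) * h s) = - integral {x..y} (\<lambda>s. - m s * \<phi> s)"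
      by simp
    then have "integral {x..y} (\<lambda>s. exp (\<Gamma> s) * h s)
        = m x * (H c - H x) + m y * (H y - H c)"
      using eq H_diff[of x c] H_diff[of c y] c xy by simp
    moreover have "u x * exp (\<Gamma> x) + integral {x..y} (\<lambda>s. exp (\<Gamma> s) * h s) \<le> u y * exp (\<Gamma> y)"
      unfolding \<Gamma>_def by (rule integrating_factor_increment[OF G h u xy])
    ultimately have "(m x - m y) * H c \<le> V y - V x"
      by (simp add: V_def algebra_simps)
    with c show ?thesis by blast
  qed
  have V_mono: "V x \<le> V y" if xy: "a \<le> x" "x \<le> y" "y \<le> b" for x y
  proof -
    obtain c where "c \<in> {x..y}" "(m x - m y) * H c \<le> V y - V x"
      using V_step[OF xy] by blast
    moreover have "0 \<le> (m x - m y) * H c"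
      using m_antimono[OF xy] H_nonneg[of c] \<open>c \<in> {x..y}\<close> xy by simp
    ultimately show ?thesis by linarith
  qed
  have Va: "V a = u a - \<gamma>"
    by (simp add: V_def m_def \<Gamma>_def Q_def H_def)
  have split: "u t * exp (\<Gamma> t) = V t + m t * H t"
    by (simp add: V_def)
  have mH: "0 \<le> m t * H t"
    using m_pos[of t] H_nonneg[OF t] by simp
  have Vt: "V a \<le> V t"
    using V_mono[of a t] t by simp
  have "0 \<le> u t * exp (\<Gamma> t)"
    using split mH Vt Va ua by linarith
  then show "0 \<le> u t"
    by (simp add: zero_le_mult_iff)
  assume pos: "0 < u a" and strict: "\<And>s. a < s \<Longrightarrow> s \<le> b \<Longrightarrow> integral {a..s} G < integral {a..s} q"
  \<comment> \<open>If \<open>u a = \<gamma>\<close> then \<open>V a = 0\<close>, but \<open>H a = \<gamma> > 0\<close>. On a short interval \<open>[a, r]\<close> the function \<open>H\<close>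
    stays positive, so the drop of \<open>m\<close> lifts \<open>V r\<close> above \<open>0\<close>, and \<open>V\<close> cannot fall back.\<close>
  have "0 < V t" if at: "a < t" and "u a = \<gamma>"
  proof -
    have "continuous_on {a..b} H"
      unfolding H_def by (intro continuous_intros indefinite_integral_continuous_1 \<phi>i)
    then have "(H \<longlongrightarrow> H a) (at a within {a..b})"
      using t by (simp add: continuous_on_def)
    then have "\<forall>\<^sub>F x in at a within {a..b}. 0 < H x"
      by (rule order_tendstoD) (use pos that in \<open>simp add: H_def\<close>)
    then obtain e where e: "e > 0" "\<And>x. x \<in> {a..b} \<Longrightarrow> x \<noteq> a \<Longrightarrow> dist x a < e \<Longrightarrow> 0 < H x"
      unfolding eventually_at by blast
    define r where "r = min t (a + e / 2)"
    have r: "a < r" "r \<le> t" "r \<le> b" and re: "r - a < e"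
      using at t e(1) by (auto simp: r_def min_def)
    obtain c where c: "c \<in> {a..r}" "(m a - m r) * H c \<le> V r - V a"
      using V_step[of a r] r by auto
    have "0 < H c"
    proof (cases "c = a")
      case True
      then show ?thesis using pos that by (simp add: H_def)
    next
      case False
      then show ?thesis using e(2)[of c] c(1) r re by (auto simp: dist_real_def)
    qed
    moreover have "m r < m a"
      using strict[OF r(1,3)] by (simp add: m_def \<Gamma>_def Q_def)
    ultimately have "V a < V r"
      using c(2) mult_pos_pos[of "m a - m r" "H c"] by linarith
    also have "V r \<le> V t" using V_mono[of r t] r t by simp
    finally show ?thesis using Va ua by simp
  qed
  then have "0 < u t * exp (\<Gamma> t)" if "a < t"
    using that split mH Vt Va ua by (cases "u a = \<gamma>") auto
  then show "0 < u t"
    using pos t by (cases "a = t") (auto simp: zero_less_mult_iff)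
qed

section \<open>Comparison for the cubic equation\<close>

text \<open>
  With \<open>\<beta> = b / a\<close> the claim is \<open>a (y\<^sup>2 + y z + z\<^sup>2 + \<beta> (y + z) + \<beta>\<^sup>2 - (y - z)\<^sup>2 / 4) \<le> 0\<close>, and the factor
  of \<open>a\<close> is a sum of two squares. The term \<open>a (y - z)\<^sup>2 / 4\<close> on the right is a margin that makes the
  comparison strict as long as \<open>y\<close> and \<open>z\<close> differ.
\<close>

lemma cubic_quotient_le:
  fixes a b c y z :: real
  assumes "a < 0"
  shows "a * (y\<^sup>2 + y * z + z\<^sup>2) + b * (y + z) + c \<le> c - b\<^sup>2 / a + a * (y - z)\<^sup>2 / 4"
proof -
  define \<beta> where "\<beta> = b / a"
  have b: "b = \<beta> * a" using assms by (simp add: \<beta>_def)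
  have "0 \<le> (y + z)\<^sup>2 / 2 + (y + z + 2 * \<beta>)\<^sup>2 / 4"
    by simp
  also have "\<dots> = y\<^sup>2 + y * z + z\<^sup>2 + \<beta> * (y + z) + \<beta>\<^sup>2 - (y - z)\<^sup>2 / 4"
    by (simp add: power2_eq_square field_simps)
  finally have "a * (y\<^sup>2 + y * z + z\<^sup>2 + \<beta> * (y + z) + \<beta>\<^sup>2 - (y - z)\<^sup>2 / 4) \<le> 0"
    using assms by (simp add: mult_le_0_iff)
  moreover have "b\<^sup>2 / a = a * \<beta>\<^sup>2"
    using assms by (simp add: b power2_eq_square)
  ultimately show ?thesis
    by (simp add: b algebra_simps)
qed

lemma cubic_ode_solution_imp_supersolution:
  "cubic_ode_solution a b c d J y \<Longrightarrow> cubic_supersolution a b c d J y"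
  unfolding cubic_ode_solution_def cubic_supersolution_def by (metis order_refl)

lemma cubic_ode_solution_subset:
  "cubic_ode_solution a b c d J y \<Longrightarrow> K \<subseteq> J \<Longrightarrow> cubic_ode_solution a b c d K y"
  unfolding cubic_ode_solution_def by (meson DERIV_subset subsetD)

lemma cubic_supersolution_subset:
  "cubic_supersolution a b c d J y \<Longrightarrow> K \<subseteq> J \<Longrightarrow> cubic_supersolution a b c d K y"
  unfolding cubic_supersolution_def by (meson DERIV_subset subsetD)

lemma cubic_supersolution_continuous:
  "cubic_supersolution a b c d J y \<Longrightarrow> continuous_on J y"
  unfolding cubic_supersolution_def continuous_on_eq_continuous_within
  using DERIV_continuous by blast

text \<open>
  The factorisations of \<open>y\<^sup>3 - z\<^sup>3\<close> and \<open>y\<^sup>2 - z\<^sup>2\<close> pull out \<open>y - z\<close>; the difference of the coefficients,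
  evaluated along \<open>z\<close>, becomes the inhomogeneity.
\<close>

lemma cubic_difference_derivative:
  assumes z: "cubic_ode_solution a1 b1 c1 d1 J z"
    and y: "cubic_supersolution a b c d J y"
    and x: "x \<in> J"
  shows "\<exists>D. ((\<lambda>x. y x - z x) has_real_derivative D) (at x within J) \<and>
    D + (a x * ((y x)\<^sup>2 + y x * z x + (z x)\<^sup>2) + b x * (y x + z x) + c x) * (y x - z x)
    \<ge> (a1 x - a x) * z x ^ 3 + (b1 x - b x) * z x ^ 2 + (c1 x - c x) * z x + d1 x - d x"
proof -
  obtain D where D: "(y has_real_derivative D) (at x within J)"
      "D + a x * y x ^ 3 + b x * y x ^ 2 + c x * y x + d x \<ge> 0"
    using y x unfolding cubic_supersolution_def by blast
  obtain E where E: "(z has_real_derivative E) (at x within J)"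
      "E + a1 x * z x ^ 3 + b1 x * z x ^ 2 + c1 x * z x + d1 x = 0"
    using z x unfolding cubic_ode_solution_def by blast
  have "((\<lambda>x. y x - z x) has_real_derivative D - E) (at x within J)"
    by (intro derivative_intros D E)
  moreover have "D - E + (a x * ((y x)\<^sup>2 + y x * z x + (z x)\<^sup>2) + b x * (y x + z x) + c x) * (y x - z x)
    \<ge> (a1 x - a x) * z x ^ 3 + (b1 x - b x) * z x ^ 2 + (c1 x - c x) * z x + d1 x - d x"
    using D(2) E(2) by (simp add: power2_eq_square power3_eq_cube algebra_simps)
  ultimately show ?thesis by blast
qed

text \<open>
  The factor \<open>k\<close> is the exponential of an integral along the two functions. Both the weak and the
  strict comparison can be read off from its positivity.
\<close>

lemma cubic_supersolution_increment:
  assumes cont: "continuous_on {t0..T} a" "continuous_on {t0..T} b" "continuous_on {t0..T} c"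
    and z: "cubic_ode_solution a b c d {t0..T} z"
    and y: "cubic_supersolution a b c d {t0..T} y"
    and t: "t \<in> {t0..T}"
  shows "\<exists>k>0. y t0 - z t0 \<le> k * (y t - z t)"
proof -
  let ?G = "\<lambda>x. a x * ((y x)\<^sup>2 + y x * z x + (z x)\<^sup>2) + b x * (y x + z x) + c x"
  have yz: "continuous_on {t0..T} y" "continuous_on {t0..T} z"
    using y z cubic_ode_solution_imp_supersolution cubic_supersolution_continuous by blast+
  have "continuous_on {t0..T} ?G"
    by (intro continuous_intros cont yz)
  moreover have "\<exists>D. ((\<lambda>x. y x - z x) has_real_derivative D) (at x within {t0..T}) \<and>
      D + ?G x * (y x - z x) \<ge> 0" if "x \<in> {t0..T}" for x
    using cubic_difference_derivative[OF z y that] by simp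
  ultimately have "y t0 - z t0 \<le> (y t - z t) * exp (integral {t0..t} ?G)"
    using integrating_factor_increment[of t0 T ?G "\<lambda>_. 0" "\<lambda>x. y x - z x" t0 t] t by simp
  then show ?thesis
    by (intro exI[of _ "exp (integral {t0..t} ?G)"]) (simp add: mult.commute)
qed

lemma cubic_supersolution_ge_solution:
  assumes "continuous_on {t0..T} a" "continuous_on {t0..T} b" "continuous_on {t0..T} c"
    and "cubic_ode_solution a b c d {t0..T} z"
    and "cubic_supersolution a b c d {t0..T} y"
    and "t \<in> {t0..T}"
  shows "z t0 \<le> y t0 \<Longrightarrow> z t \<le> y t" and "z t0 < y t0 \<Longrightarrow> z t < y t"
proof -
  obtain k where k: "k > 0" "y t0 - z t0 \<le> k * (y t - z t)"
    using cubic_supersolution_increment[OF assms] by blast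
  show "z t \<le> y t" if "z t0 \<le> y t0"
  proof -
    have "0 \<le> k * (y t - z t)" using k that by linarith
    then show ?thesis using k(1) by (simp add: zero_le_mult_iff)
  qed
  show "z t < y t" if "z t0 < y t0"
  proof -
    have "0 < k * (y t - z t)" using k that by linarith
    then show ?thesis using k(1) by (simp add: zero_less_mult_iff)
  qed
qed

lemma cubic_ode_solution_unique:
  assumes "continuous_on {t0..T} a" "continuous_on {t0..T} b" "continuous_on {t0..T} c"
    and y: "cubic_ode_solution a b c d {t0..T} y" and z: "cubic_ode_solution a b c d {t0..T} z"
    and "y t0 = z t0" and "t \<in> {t0..T}"
  shows "y t = z t"
  using cubic_supersolution_ge_solution(1)[OF assms(1-3) y cubic_ode_solution_imp_supersolution[OF z]]
    cubic_supersolution_ge_solution(1)[OF assms(1-3) z cubic_ode_solution_imp_supersolution[OF y]]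
    assms(6,7) by (metis order_antisym order_refl)

text \<open>
  By continuity \<open>a \<le> 0\<close> everywhere, so a vanishing integral would force \<open>a w = 0\<close>, hence \<open>a = 0\<close> on an
  interval to the right of \<open>s\<close> where \<open>w > 0\<close>. Such an interval is not a null set.
\<close>

lemma integral_neg_on_subinterval:
  fixes a :: "real \<Rightarrow> real"
  assumes a: "continuous_on {s..t} a" and neg: "AE x \<in> {s..t} in lebesgue. a x < 0"
    and w: "continuous_on {s..t} w" "\<And>x. x \<in> {s..t} \<Longrightarrow> 0 \<le> w x" "0 < w s"
    and "s < t"
  shows "integral {s..t} (\<lambda>x. a x * w x) < 0"
proof -
  have cw: "continuous_on {s..t} (\<lambda>x. - (a x * w x))"
    by (intro continuous_intros a w)
  have le: "a x \<le> 0" if "x \<in> {s..t}" for x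
  proof -
    have "closed {x \<in> {s..t}. a x \<le> 0}"
      by (rule continuous_on_closed_Collect_le) (use a in auto)
    moreover have "AE x \<in> {s<..<t} in lebesgue. x \<in> {x \<in> {s..t}. a x \<le> 0}"
      using neg by (auto elim!: AE_mp)
    ultimately have "{s<..<t} \<subseteq> {x \<in> {s..t}. a x \<le> 0}"
      using mem_closed_if_AE_lebesgue_open[of "{s<..<t}" "{x \<in> {s..t}. a x \<le> 0}"]
      by (meson open_greaterThanLessThan subsetI)
    then have "closure {s<..<t} \<subseteq> {x \<in> {s..t}. a x \<le> 0}"
      using \<open>closed _\<close> by (rule closure_minimal)
    then show ?thesis using that \<open>s < t\<close> by auto
  qed
  have nonneg: "0 \<le> - (a x * w x)" if "x \<in> {s..t}" for x
    using le[OF that] w(2)[OF that] by (simp add: mult_le_0_iff)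
  have "integral {s..t} (\<lambda>x. - (a x * w x)) \<noteq> 0"
  proof
    assume "integral {s..t} (\<lambda>x. - (a x * w x)) = 0"
    then have zero: "a x * w x = 0" if "x \<in> {s..t}" for x
      using integral_eq_0_iff[OF cw \<open>s < t\<close> nonneg] that by auto
    have "(w \<longlongrightarrow> w s) (at s within {s..t})"
      using w(1) \<open>s < t\<close> by (simp add: continuous_on_def)
    then have "\<forall>\<^sub>F x in at s within {s..t}. 0 < w x"
      using w(3) by (rule order_tendstoD)
    then obtain e where e: "e > 0" "\<And>x. x \<in> {s..t} \<Longrightarrow> x \<noteq> s \<Longrightarrow> dist x s < e \<Longrightarrow> 0 < w x"
      unfolding eventually_at by blast
    define r where "r = min t (s + e)"
    have r: "s < r" using e \<open>s < t\<close> by (simp add: r_def)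
    have az: "a x = 0" if "x \<in> {s<..<r}" for x
      using zero[of x] e(2)[of x] that by (auto simp: r_def dist_real_def)
    have "AE x \<in> {s<..<r} in lebesgue. x \<in> ({} :: real set)"
      using neg az by (auto elim!: AE_mp simp: r_def)
    moreover have "(s + r) / 2 \<in> {s<..<r}"
      using r by simp
    ultimately have "(s + r) / 2 \<in> ({} :: real set)"
      by (rule mem_closed_if_AE_lebesgue_open[OF open_greaterThanLessThan closed_empty])
    then show False by simp
  qed
  moreover have "0 \<le> integral {s..t} (\<lambda>x. - (a x * w x))"
    by (rule Henstock_Kurzweil_Integration.integral_nonneg[OF integrable_continuous_real[OF cw]])
       (use nonneg in auto)
  ultimately show ?thesis by simp
qed

text \<open>
  This is \<open>weighted_comparison\<close> for \<open>u = y - z\<close> and \<open>q = c - b\<^sup>2 / a\<close>. The case \<open>t = t0\<close> of the integral condition contains \<open>z t0 \<le> \<gamma>\<close>.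
\<close>

lemma cubic_lower_comparison:
  assumes cont: "continuous_on {t0..T} a" "continuous_on {t0..T} b" "continuous_on {t0..T} c"
      "continuous_on {t0..T} d" "continuous_on {t0..T} a1" "continuous_on {t0..T} b1"
      "continuous_on {t0..T} c1" "continuous_on {t0..T} d1"
    and z: "cubic_ode_solution a1 b1 c1 d1 {t0..T} z"
    and y: "cubic_supersolution a b c d {t0..T} y"
    and neg: "AE t \<in> {t0..T} in lebesgue. a t < 0"
    and int: "set_integrable lebesgue {t0..T} (\<lambda>t. (b t)\<^sup>2 / a t)"
    and weighted: "\<And>t. t \<in> {t0..T} \<Longrightarrow>
      \<gamma> - z t0 +
      (LINT \<tau>:{t0..t}|lebesgue.
        exp (LINT s:{t0..\<tau>}|lebesgue. c s - (b s)\<^sup>2 / a s) *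
        ((a1 \<tau> - a \<tau>) * z \<tau> ^ 3 + (b1 \<tau> - b \<tau>) * z \<tau> ^ 2 + (c1 \<tau> - c \<tau>) * z \<tau>
          + d1 \<tau> - d \<tau>)) \<ge> 0"
    and init: "\<gamma> \<le> y t0"
    and t: "t \<in> {t0..T}"
  shows "z t \<le> y t" and "z t0 < y t0 \<Longrightarrow> z t < y t"
proof -
  define h where "h x = (a1 x - a x) * z x ^ 3 + (b1 x - b x) * z x ^ 2 + (c1 x - c x) * z x
    + d1 x - d x" for x
  define G where "G x = a x * ((y x)\<^sup>2 + y x * z x + (z x)\<^sup>2) + b x * (y x + z x) + c x" for x
  define q where "q x = c x - (b x)\<^sup>2 / a x" for x
  define r where "r x = a x * ((y x - z x)\<^sup>2 / 4)" for x
  have yz: "continuous_on {t0..T} y" "continuous_on {t0..T} z"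
    using y z cubic_ode_solution_imp_supersolution cubic_supersolution_continuous by blast+
  have G: "continuous_on {t0..T} G"
    unfolding G_def by (intro continuous_intros cont yz)
  have h: "continuous_on {t0..T} h"
    unfolding h_def by (intro continuous_intros cont yz)
  have r: "continuous_on {t0..T} r"
    unfolding r_def by (intro continuous_intros cont yz) simp
  have u: "\<exists>D. ((\<lambda>x. y x - z x) has_real_derivative D) (at x within {t0..T}) \<and>
      D + G x * (y x - z x) \<ge> h x" if "x \<in> {t0..T}" for x
    using cubic_difference_derivative[OF z y that] unfolding G_def h_def .
  have q: "set_integrable lebesgue {t0..T} q"
    unfolding q_def by (intro set_integral_diff absolutely_integrable_continuous_real cont int)
  have Gqr: "AE x \<in> {t0..T} in lebesgue. G x - r x \<le> q x"
    using neg
  proof (rule AE_mp, intro AE_I2 impI)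
    fix x assume "x \<in> {t0..T} \<longrightarrow> a x < 0" "x \<in> {t0..T}"
    then show "G x - r x \<le> q x"
      using cubic_quotient_le[of "a x" "y x" "z x" "b x" "c x"]
      by (simp add: G_def r_def q_def)
  qed
  have r_nonpos: "AE x \<in> {t0..T} in lebesgue. r x \<le> 0"
    using neg by (auto elim!: AE_mp simp: r_def mult_le_0_iff)
  have Gq: "AE x \<in> {t0..T} in lebesgue. G x \<le> q x"
    using Gqr r_nonpos by (auto elim!: AE_mp)
  have H: "0 \<le> \<gamma> - z t0 + integral {t0..t} (\<lambda>x. exp (integral {t0..x} q) * h x)"
    if t: "t \<in> {t0..T}" for t
  proof -
    let ?\<phi> = "\<lambda>x. exp (integral {t0..x} q) * h x"
    have qi: "(LINT s:{t0..x}|lebesgue. q s) = integral {t0..x} q" if "x \<in> {t0..T}" for x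
      by (rule set_lebesgue_integral_eq_integral(2))
         (rule set_integrable_subset[OF q], use that in auto)
    have \<phi>: "continuous_on {t0..T} ?\<phi>"
      by (intro continuous_intros indefinite_integral_continuous_1 h
          set_lebesgue_integral_eq_integral(1)[OF q])
    have "(LINT x:{t0..t}|lebesgue. exp (LINT s:{t0..x}|lebesgue. q s) * h x)
        = (LINT x:{t0..t}|lebesgue. ?\<phi> x)"
      by (rule set_lebesgue_integral_cong) (use qi t in auto)
    also have "\<dots> = integral {t0..t} ?\<phi>"
      by (rule set_lebesgue_integral_eq_integral(2), rule absolutely_integrable_continuous_real,
          rule continuous_on_subset[OF \<phi>]) (use t in auto)
    finally show ?thesis
      using weighted[OF t] unfolding q_def h_def by simp
  qed
  note comparison = weighted_comparison[where u = "\<lambda>x. y x - z x" and \<gamma> = "\<gamma> - z t0",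
      OF G h u q Gq H _ t]
  show "z t \<le> y t"
    using comparison(1) init by simp
  assume pos: "z t0 < y t0"
  \<comment> \<open>Here the margin \<open>r\<close> enters: it has negative integral because \<open>y\<close> and \<open>z\<close> differ at \<open>t0\<close>.\<close>
  have "integral {t0..s} G < integral {t0..s} q" if s: "t0 < s" "s \<le> T" for s
  proof -
    have sub: "{t0..s} \<subseteq> {t0..T}" using s by auto
    note cs = continuous_on_subset[OF _ sub]
    have Gr: "set_integrable lebesgue {t0..s} (\<lambda>x. G x - r x)"
      by (intro absolutely_integrable_continuous_real continuous_intros cs[OF G] cs[OF r])
    have qs: "set_integrable lebesgue {t0..s} q"
      by (rule set_integrable_subset[OF q _ sub]) simp
    have "(LINT x:{t0..s}|lebesgue. G x - r x) \<le> (LINT x:{t0..s}|lebesgue. q x)"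
      by (rule set_integral_mono_AE[OF Gr qs]) (use Gqr sub in \<open>auto elim!: AE_mp\<close>)
    then have "integral {t0..s} (\<lambda>x. G x - r x) \<le> integral {t0..s} q"
      using set_lebesgue_integral_eq_integral(2)[OF Gr] set_lebesgue_integral_eq_integral(2)[OF qs]
      by simp
    moreover have "integral {t0..s} (\<lambda>x. G x - r x) = integral {t0..s} G - integral {t0..s} r"
      by (intro Henstock_Kurzweil_Integration.integral_diff integrable_continuous_real
          cs[OF G] cs[OF r])
    moreover have "integral {t0..s} r < 0"
      unfolding r_def
    proof (rule integral_neg_on_subinterval[OF cs[OF cont(1)] _ _ _ _ s(1)])
      show "AE x \<in> {t0..s} in lebesgue. a x < 0"
        using neg sub by (auto elim!: AE_mp)
      show "continuous_on {t0..s} (\<lambda>x. (y x - z x)\<^sup>2 / 4)"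
        by (intro continuous_intros cs[OF yz(1)] cs[OF yz(2)]) simp
    qed (use pos in auto)
    ultimately show ?thesis by linarith
  qed
  then show "z t < y t"
    using comparison(2) init pos by simp
qed

section \<open>Existence\<close>

text \<open>
  The Picard map is made a contraction on the whole interval by the substitution
  \<open>y t = exp (K (t - a)) w t\<close>, that is, by Bielecki's weighted norm: its Lipschitz constant in the
  supremum norm of \<open>w\<close> is at most \<open>L / K\<close>, and \<open>K = 2 (L + 1)\<close> is positive even if \<open>L = 0\<close>.
\<close>

lemma picard_lindelof_lipschitz:
  fixes F :: "real \<Rightarrow> real \<Rightarrow> real"
  assumes "a \<le> b" and "0 \<le> L"
    and cont: "\<And>w. continuous_on {a..b} w \<Longrightarrow> continuous_on {a..b} (\<lambda>t. F t (w t))"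
    and lip: "\<And>t x y. t \<in> {a..b} \<Longrightarrow> \<bar>F t x - F t y\<bar> \<le> L * \<bar>x - y\<bar>"
  shows "\<exists>y. y a = y0 \<and> (\<forall>t\<in>{a..b}. (y has_real_derivative F t (y t)) (at t within {a..b}))"
proof -
  define K where "K = 2 * (L + 1)"
  have K: "K > 0" "L / K \<le> 1 / 2"
    using \<open>0 \<le> L\<close> by (auto simp: K_def field_simps)
  define P where "P w t = exp (- K * (t - a)) *
    (y0 + integral {a..t} (\<lambda>s. F s (exp (K * (s - a)) * w s)))" for w t
  have cF: "continuous_on {a..b} (\<lambda>s. F s (exp (K * (s - a)) * apply_bcontfun w s))"
    for w :: "real \<Rightarrow>\<^sub>C real"
    by (rule cont) (intro continuous_intros continuous_on_apply_bcontfun)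
  \<comment> \<open>Bounded continuous functions live on all of \<open>real\<close>, so values are extended from \<open>[a, b]\<close> by clamping.\<close>
  have "\<exists>v::real \<Rightarrow>\<^sub>C real. (\<forall>t\<in>{a..b}. apply_bcontfun v t = P w t) \<and>
      (\<forall>t. apply_bcontfun v t = P w (clamp a b t))" for w :: "real \<Rightarrow>\<^sub>C real"
  proof -
    have "continuous_on (cbox a b) (P w)"
      unfolding P_def box_real
      by (intro continuous_intros indefinite_integral_continuous_1 integrable_continuous_real cF)
    then show ?thesis
      by (metis continuous_on_cbox_bcontfunE box_real(2))
  qed
  then obtain \<Phi> :: "(real \<Rightarrow>\<^sub>C real) \<Rightarrow> (real \<Rightarrow>\<^sub>C real)" where
    \<Phi>: "\<And>w t. t \<in> {a..b} \<Longrightarrow> apply_bcontfun (\<Phi> w) t = P w t"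
    and \<Phi>_clamp: "\<And>w t. apply_bcontfun (\<Phi> w) t = P w (clamp a b t)"
    by metis
  have contraction: "dist (\<Phi> v) (\<Phi> w) \<le> 1 / 2 * dist v w" for v w
  proof (rule dist_bound)
    fix x
    define t where "t = clamp a b x"
    have t: "t \<in> {a..b}"
      using clamp_in_interval[of a b x] \<open>a \<le> b\<close> by (simp add: t_def)
    let ?f = "\<lambda>w s. F s (exp (K * (s - a)) * apply_bcontfun w s)"
    let ?g = "\<lambda>s. L * dist v w * exp (K * (s - a))"
    have fi: "?f w integrable_on {a..t}" for w
      by (rule integrable_continuous_real[OF continuous_on_subset[OF cF]]) (use t in auto)
    have gi: "(?g has_integral (L * dist v w * exp (K * (t - a)) / K
        - L * dist v w * exp (K * (a - a)) / K)) {a..t}"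
    proof (rule fundamental_theorem_of_calculus)
      fix s
      show "((\<lambda>s. L * dist v w * exp (K * (s - a)) / K) has_vector_derivative ?g s) (at s within {a..t})"
        unfolding has_real_derivative_iff_has_vector_derivative[symmetric]
        using K(1) by (auto intro!: derivative_eq_intros)
    qed (use t in auto)
    have pointwise: "norm (?f v s - ?f w s) \<le> ?g s" if "s \<in> {a..t}" for s
    proof -
      have "\<bar>?f v s - ?f w s\<bar> \<le> L * \<bar>exp (K * (s - a)) * v s - exp (K * (s - a)) * w s\<bar>"
        by (rule lip) (use that t in auto)
      also have "\<dots> = L * (exp (K * (s - a)) * dist (v s) (w s))"
        by (simp add: dist_real_def abs_mult flip: right_diff_distrib)
      also have "\<dots> \<le> L * (exp (K * (s - a)) * dist v w)"
        by (intro mult_left_mono dist_bounded \<open>0 \<le> L\<close>) simp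
      finally show ?thesis by (simp add: mult_ac)
    qed
    have "\<bar>integral {a..t} (?f v) - integral {a..t} (?f w)\<bar>
        = norm (integral {a..t} (\<lambda>s. ?f v s - ?f w s))"
      by (simp add: Henstock_Kurzweil_Integration.integral_diff fi)
    also have "\<dots> \<le> integral {a..t} ?g"
      by (rule integral_norm_bound_integral[OF integrable_diff[OF fi fi] _ pointwise])
         (use gi in auto)
    also have "\<dots> = L * dist v w * exp (K * (t - a)) / K - L * dist v w / K"
      unfolding integral_unique[OF gi] by simp
    also have "\<dots> \<le> L * dist v w * exp (K * (t - a)) / K"
      using K(1) \<open>0 \<le> L\<close> by simp
    finally have bound: "\<bar>integral {a..t} (?f v) - integral {a..t} (?f w)\<bar>
      \<le> L * dist v w * exp (K * (t - a)) / K" .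
    have "dist (\<Phi> v x) (\<Phi> w x)
        = exp (- K * (t - a)) * \<bar>integral {a..t} (?f v) - integral {a..t} (?f w)\<bar>"
      unfolding \<Phi>_clamp t_def[symmetric] P_def dist_real_def
      by (simp add: abs_mult flip: right_diff_distrib)
    also have "\<dots> \<le> exp (- K * (t - a)) * (L * dist v w * exp (K * (t - a)) / K)"
      by (intro mult_left_mono bound) simp
    also have "\<dots> = L / K * dist v w"
      by (simp add: exp_minus)
    also have "\<dots> \<le> 1 / 2 * dist v w"
      by (intro mult_right_mono K) simp
    finally show "dist (\<Phi> v x) (\<Phi> w x) \<le> 1 / 2 * dist v w" .
  qed
  obtain w where w: "\<Phi> w = w"
    using banach_fix_type[of "1 / 2" \<Phi>] contraction by auto
  define f where "f s = F s (exp (K * (s - a)) * apply_bcontfun w s)" for s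
  define y where "y t = y0 + integral {a..t} f" for t
  have yw: "exp (K * (t - a)) * w t = y t" if "t \<in> {a..b}" for t
  proof -
    have "w t = exp (- (K * (t - a))) * y t"
      using \<Phi>[OF that, of w] unfolding w P_def y_def f_def by simp
    then show ?thesis by (simp add: exp_minus)
  qed
  have "(y has_real_derivative F t (y t)) (at t within {a..b})" if t: "t \<in> {a..b}" for t
  proof -
    have "continuous_on {a..b} f"
      unfolding f_def by (rule cF)
    then have "(y has_real_derivative 0 + f t) (at t within {a..b})"
      unfolding y_def by (intro DERIV_add DERIV_const integral_has_real_derivative t)
    then show ?thesis using yw[OF t] by (simp add: f_def)
  qed
  moreover have "y a = y0" by (simp add: y_def)
  ultimately show ?thesis by blast
qed

text \<open>
  An a priori bound on all solutions starting at \<open>y0\<close> gives existence. A solution of the truncated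
  equation that reached \<open>\<bar>y\<bar> = M\<close> would, up to the first such time, solve the cubic equation itself,
  contrary to the strict bound.
\<close>

lemma cubic_ivp_exists_if_bounded:
  assumes "t0 \<le> T"
    and cont: "continuous_on {t0..T} a" "continuous_on {t0..T} b" "continuous_on {t0..T} c"
      "continuous_on {t0..T} d"
    and init: "\<bar>y0\<bar> < M"
    and bound: "\<And>s y. s \<in> {t0..T} \<Longrightarrow> cubic_ode_solution a b c d {t0..s} y \<Longrightarrow> y t0 = y0 \<Longrightarrow>
      \<bar>y s\<bar> < M"
  shows "\<exists>y. cubic_ode_solution a b c d {t0..T} y \<and> y t0 = y0"
proof -
  define p where "p x = max (- M) (min M x)" for x :: real
  define F where "F t x = - (a t * p x ^ 3 + b t * p x ^ 2 + c t * p x + d t)" for t x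
  have M: "0 < M" using init by simp
  have p_bound: "\<bar>p x\<bar> \<le> M" for x
    using M by (auto simp: p_def)
  have p_lip: "\<bar>p x - p y\<bar> \<le> \<bar>x - y\<bar>" for x y
    by (auto simp: p_def max_def min_def)
  have p_id: "p x = x" if "\<bar>x\<bar> \<le> M" for x
    using that by (auto simp: p_def)
  have "\<exists>C\<ge>0. \<forall>t\<in>{t0..T}. \<bar>f t\<bar> \<le> C" if "continuous_on {t0..T} f" for f :: "real \<Rightarrow> real"
  proof -
    have "bounded (f ` {t0..T})"
      using that by (intro compact_imp_bounded compact_continuous_image compact_Icc)
    then obtain C where "C > 0" "\<forall>x\<in>f ` {t0..T}. norm x \<le> C"
      unfolding bounded_pos by blast
    then show ?thesis by (intro exI[of _ C]) auto
  qed
  then obtain A B C where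
    A: "A \<ge> 0" "\<And>t. t \<in> {t0..T} \<Longrightarrow> \<bar>a t\<bar> \<le> A" and
    B: "B \<ge> 0" "\<And>t. t \<in> {t0..T} \<Longrightarrow> \<bar>b t\<bar> \<le> B" and
    C: "C \<ge> 0" "\<And>t. t \<in> {t0..T} \<Longrightarrow> \<bar>c t\<bar> \<le> C"
    using cont(1-3) by metis
  define L where "L = A * (3 * M\<^sup>2) + B * (2 * M) + C"
  have "0 \<le> L" using A(1) B(1) C(1) M by (simp add: L_def)
  have lip: "\<bar>F t x - F t y\<bar> \<le> L * \<bar>x - y\<bar>" if t: "t \<in> {t0..T}" for t x y
  proof -
    let ?P = "p x" and ?R = "p y"
    let ?S = "a t * (?P\<^sup>2 + ?P * ?R + ?R\<^sup>2) + b t * (?P + ?R) + c t"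
    have prod: "\<bar>r * s\<bar> \<le> M\<^sup>2" if "\<bar>r\<bar> \<le> M" "\<bar>s\<bar> \<le> M" for r s
      using mult_mono[OF that] M by (simp add: abs_mult power2_eq_square)
    have "\<bar>?P * ?P\<bar> \<le> M\<^sup>2" "\<bar>?P * ?R\<bar> \<le> M\<^sup>2" "\<bar>?R * ?R\<bar> \<le> M\<^sup>2"
      by (intro prod p_bound)+
    then have "\<bar>?P\<^sup>2 + ?P * ?R + ?R\<^sup>2\<bar> \<le> 3 * M\<^sup>2"
      unfolding power2_eq_square by linarith
    then have "\<bar>a t * (?P\<^sup>2 + ?P * ?R + ?R\<^sup>2)\<bar> \<le> A * (3 * M\<^sup>2)"
      unfolding abs_mult by (intro mult_mono A t) auto
    moreover have "\<bar>b t * (?P + ?R)\<bar> \<le> B * (2 * M)"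
      unfolding abs_mult using p_bound[of x] p_bound[of y] by (intro mult_mono B t) auto
    ultimately have S: "\<bar>?S\<bar> \<le> L"
      using C(2)[OF t] by (simp add: L_def)
    have "F t x - F t y = - (?S * (?P - ?R))"
      by (simp add: F_def power2_eq_square power3_eq_cube algebra_simps)
    then have "\<bar>F t x - F t y\<bar> = \<bar>?S\<bar> * \<bar>?P - ?R\<bar>"
      by (simp add: abs_mult)
    also have "\<dots> \<le> L * \<bar>x - y\<bar>"
      by (rule mult_mono[OF S p_lip \<open>0 \<le> L\<close>]) simp
    finally show ?thesis .
  qed
  have "continuous_on {t0..T} (\<lambda>t. F t (w t))" if "continuous_on {t0..T} w" for w
    unfolding F_def p_def by (intro continuous_intros cont that)
  then obtain y where y0: "y t0 = y0"
    and y: "\<And>t. t \<in> {t0..T} \<Longrightarrow> (y has_real_derivative F t (y t)) (at t within {t0..T})"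
    using picard_lindelof_lipschitz[of t0 T L F y0] \<open>t0 \<le> T\<close> \<open>0 \<le> L\<close> lip by blast
  have yc: "continuous_on {t0..T} y"
    using y by (meson DERIV_continuous continuous_on_eq_continuous_within)
  have untruncated: "cubic_ode_solution a b c d {t0..s} y"
    if s: "s \<in> {t0..T}" and le: "\<And>t. t \<in> {t0..s} \<Longrightarrow> \<bar>y t\<bar> \<le> M" for s
    unfolding cubic_ode_solution_def
  proof
    fix t assume t: "t \<in> {t0..s}"
    have "(y has_real_derivative F t (y t)) (at t within {t0..s})"
      by (rule DERIV_subset[OF y]) (use s t in auto)
    moreover have "F t (y t) + a t * y t ^ 3 + b t * y t ^ 2 + c t * y t + d t = 0"
      using p_id[OF le[OF t]] by (simp add: F_def)
    ultimately show "\<exists>D. (y has_real_derivative D) (at t within {t0..s}) \<and>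
        D + a t * y t ^ 3 + b t * y t ^ 2 + c t * y t + d t = 0" by blast
  qed
  have crossing: "\<exists>s\<in>{t0..t}. \<bar>y s\<bar> = M" if t: "t \<in> {t0..T}" and "M \<le> \<bar>y t\<bar>" for t
    using IVT'[of "\<lambda>s. \<bar>y s\<bar>" t0 M t] that init y0
      continuous_on_subset[OF continuous_on_rabs[OF yc], of "{t0..t}"] by auto
  have "\<bar>y t\<bar> \<le> M" if t: "t \<in> {t0..T}" for t
  proof (rule ccontr)
    assume "\<not> \<bar>y t\<bar> \<le> M"
    define S where "S = {s \<in> {t0..T}. \<bar>y s\<bar> = M}"
    have "S \<noteq> {}"
      using crossing[OF t] t \<open>\<not> \<bar>y t\<bar> \<le> M\<close> by (force simp: S_def)
    moreover have "closed S"
      unfolding S_def by (rule continuous_closed_preimage_constant[OF continuous_on_rabs[OF yc]]) simp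
    then have "compact ({t0..T} \<inter> S)"
      by (intro compact_Int_closed compact_Icc)
    moreover have "{t0..T} \<inter> S = S"
      by (auto simp: S_def)
    ultimately obtain s where s: "s \<in> S" and least: "\<And>r. r \<in> S \<Longrightarrow> s \<le> r"
      using compact_attains_inf[of S] by metis
    have "\<bar>y r\<bar> \<le> M" if r: "r \<in> {t0..s}" for r
    proof (rule ccontr)
      assume "\<not> \<bar>y r\<bar> \<le> M"
      then obtain q where "q \<in> {t0..r}" "\<bar>y q\<bar> = M"
        using crossing[of r] r s by (auto simp: S_def)
      then have "q = s"
        using least[of q] r s by (auto simp: S_def)
      then have "r = s" using \<open>q \<in> {t0..r}\<close> r by simp
      then show False using s \<open>\<not> \<bar>y r\<bar> \<le> M\<close> by (simp add: S_def)
    qed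
    then have "cubic_ode_solution a b c d {t0..s} y"
      using s by (intro untruncated) (auto simp: S_def)
    then have "\<bar>y s\<bar> < M"
      using bound[of s y] s y0 by (auto simp: S_def)
    then show False using s by (simp add: S_def)
  qed
  then have "cubic_ode_solution a b c d {t0..T} y"
    using \<open>t0 \<le> T\<close> by (intro untruncated) auto
  with y0 show ?thesis by blast
qed

lemma half_open_larger:
  assumes "t \<in> half_open t0 \<tau>"
  obtains T where "t < T" "T \<in> half_open t0 \<tau>"
proof -
  obtain T where "ereal t < ereal T" "ereal T < \<tau>"
    using assms ereal_dense2[of "ereal t" \<tau>] by (auto simp: half_open_def)
  then show thesis
    using that[of T] assms by (simp add: half_open_def)
qed

lemma Icc_subset_half_open:
  "T \<in> half_open t0 \<tau> \<Longrightarrow> {t0..T} \<subseteq> half_open t0 \<tau>"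
  by (auto simp: half_open_def intro: le_less_trans[of _ "ereal T"])

lemma cubic_ode_solution_cong:
  assumes y: "cubic_ode_solution a b c d J y" and eq: "\<And>t. t \<in> J \<Longrightarrow> y t = z t"
  shows "cubic_ode_solution a b c d J z"
  unfolding cubic_ode_solution_def
proof
  fix t assume t: "t \<in> J"
  then obtain D where D: "(y has_real_derivative D) (at t within J)"
      "D + a t * y t ^ 3 + b t * y t ^ 2 + c t * y t + d t = 0"
    using y unfolding cubic_ode_solution_def by blast
  have "(z has_real_derivative D) (at t within J)"
    by (rule has_field_derivative_transform_within[OF D(1) zero_less_one t]) (rule eq)
  then show "\<exists>D. (z has_real_derivative D) (at t within J) \<and>
      D + a t * z t ^ 3 + b t * z t ^ 2 + c t * z t + d t = 0"
    using D(2) eq[OF t] by auto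
qed

lemma cubic_ode_solution_half_openI:
  assumes "\<And>T. T \<in> half_open t0 \<tau> \<Longrightarrow> cubic_ode_solution a b c d {t0..T} y"
  shows "cubic_ode_solution a b c d (half_open t0 \<tau>) y"
  unfolding cubic_ode_solution_def
proof
  fix t assume t: "t \<in> half_open t0 \<tau>"
  \<comment> \<open>The interval must reach beyond \<open>t\<close>, so that the derivative at \<open>t\<close> is two-sided where it should be.\<close>
  obtain T where T: "t < T" "T \<in> half_open t0 \<tau>"
    using half_open_larger[OF t] .
  have "at t within {t0..T} = at t within half_open t0 \<tau>"
    by (rule at_within_nhd[of _ "{..<T}"])
       (use T Icc_subset_half_open[OF T(2)] in \<open>auto simp: half_open_def\<close>)
  moreover have "t \<in> {t0..T}" using t T by (simp add: half_open_def)
  ultimately show "\<exists>D. (y has_real_derivative D) (at t within half_open t0 \<tau>) \<and>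
      D + a t * y t ^ 3 + b t * y t ^ 2 + c t * y t + d t = 0"
    using assms[OF T(2)] unfolding cubic_ode_solution_def by metis
qed

text \<open>
  The pieces are glued along the diagonal: the value at \<open>t\<close> is taken from the solution on
  \<open>[t0, t]\<close>. Uniqueness makes this agree with every solution on a longer interval, and likewise with
  any solution given on an initial piece, which is thereby continued.
\<close>

lemma cubic_ivp_exists_on_if_Icc:
  assumes cont: "continuous_on (half_open t0 \<tau>0) a" "continuous_on (half_open t0 \<tau>0) b"
      "continuous_on (half_open t0 \<tau>0) c"
    and ex: "\<And>T. T \<in> half_open t0 \<tau>0 \<Longrightarrow> \<exists>y. cubic_ode_solution a b c d {t0..T} y \<and> y t0 = y0"
    and "ereal t0 < \<tau>0"
  shows "cubic_ivp_exists_on a b c d t0 \<tau>0 y0"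
proof -
  note contT = continuous_on_subset[OF _ Icc_subset_half_open]
  obtain Y where Y: "\<And>T. T \<in> half_open t0 \<tau>0 \<Longrightarrow> cubic_ode_solution a b c d {t0..T} (Y T)"
      "\<And>T. T \<in> half_open t0 \<tau>0 \<Longrightarrow> Y T t0 = y0"
    using ex by metis
  have Y_eq: "z t = Y t t" if "T \<in> half_open t0 \<tau>0" "cubic_ode_solution a b c d {t0..T} z"
    "z t0 = y0" "t \<in> {t0..T}" for T z t
  proof -
    have t: "t \<in> half_open t0 \<tau>0"
      using that(1,4) Icc_subset_half_open by blast
    have "cubic_ode_solution a b c d {t0..t} z"
      by (rule cubic_ode_solution_subset[OF that(2)]) (use that(4) in auto)
    then show ?thesis
      by (rule cubic_ode_solution_unique[OF contT[OF cont(1) t] contT[OF cont(2) t]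
            contT[OF cont(3) t] _ Y(1)[OF t]])
         (use Y(2)[OF t] that(3,4) in auto)
  qed
  define y where "y t = Y t t" for t
  have sol: "cubic_ode_solution a b c d (half_open t0 \<tau>0) y"
  proof (rule cubic_ode_solution_half_openI)
    fix T assume T: "T \<in> half_open t0 \<tau>0"
    show "cubic_ode_solution a b c d {t0..T} y"
      by (rule cubic_ode_solution_cong[OF Y(1)[OF T]])
         (use Y_eq[OF T Y(1)[OF T] Y(2)[OF T]] in \<open>simp add: y_def\<close>)
  qed
  have init: "y t0 = y0"
    using Y(2)[of t0] \<open>ereal t0 < \<tau>0\<close> by (simp add: y_def half_open_def)
  have "y t = z t" if "\<tau> \<le> \<tau>0" and z: "cubic_ode_solution a b c d (half_open t0 \<tau>) z" "z t0 = y0"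
    and t: "t \<in> half_open t0 \<tau>" for \<tau> z t
  proof -
    have "t \<in> half_open t0 \<tau>0"
      using t \<open>\<tau> \<le> \<tau>0\<close> by (auto simp: half_open_def)
    moreover have "cubic_ode_solution a b c d {t0..t} z"
      by (rule cubic_ode_solution_subset[OF z(1) Icc_subset_half_open[OF t]])
    ultimately show ?thesis
      using Y_eq[of t z t] z(2) t by (simp add: y_def half_open_def)
  qed
  then show ?thesis
    unfolding cubic_ivp_exists_on_def using sol init by blast
qed

section \<open>Global existence between the two bounds\<close>

theorem theorem3p1:
  fixes t0 :: real and \<tau>0 :: ereal
    and a b c d a1 b1 c1 d1 y1 \<eta> :: "real \<Rightarrow> real" and \<gamma> :: real
  assumes "ereal t0 < \<tau>0"
    and "continuous_on (half_open t0 \<tau>0) a" and "continuous_on (half_open t0 \<tau>0) b"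
    and "continuous_on (half_open t0 \<tau>0) c" and "continuous_on (half_open t0 \<tau>0) d"
    and "continuous_on (half_open t0 \<tau>0) a1" and "continuous_on (half_open t0 \<tau>0) b1"
    and "continuous_on (half_open t0 \<tau>0) c1" and "continuous_on (half_open t0 \<tau>0) d1"
    and "cubic_ode_solution a1 b1 c1 d1 (half_open t0 \<tau>0) y1"
    and "cubic_supersolution a b c d (half_open t0 \<tau>0) \<eta>"
    and "\<eta> t0 \<ge> y1 t0"
    and "AE t \<in> half_open t0 \<tau>0 in lebesgue. a t < 0"
    and "locally_integrable_on (\<lambda>t. (b t)^2 / a t) t0 \<tau>0"
    and "\<gamma> \<in> {y1 t0..\<eta> t0}"
    and "\<forall>t\<in>half_open t0 \<tau>0.
      \<gamma> - y1 t0 +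
      (LINT \<tau>:{t0..t}|lebesgue.
        exp (LINT s:{t0..\<tau>}|lebesgue. c s - (b s)^2 / a s) *
        ((a1 \<tau> - a \<tau>) * y1 \<tau> ^ 3 + (b1 \<tau> - b \<tau>) * y1 \<tau> ^ 2 + (c1 \<tau> - c \<tau>) * y1 \<tau>
          + d1 \<tau> - d \<tau>)) \<ge> 0"
  shows "\<forall>y0\<in>{\<gamma>..\<eta> t0}.
    cubic_ivp_exists_on a b c d t0 \<tau>0 y0 \<and>
    (\<forall>y. cubic_ode_solution a b c d (half_open t0 \<tau>0) y \<and> y t0 = y0 \<longrightarrow>
      (\<forall>t\<in>half_open t0 \<tau>0. y1 t \<le> y t \<and> y t \<le> \<eta> t) \<and>
      (y1 t0 < y t0 \<longrightarrow> (\<forall>t\<in>half_open t0 \<tau>0. y1 t < y t)) \<and>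
      (y t0 < \<eta> t0 \<longrightarrow> (\<forall>t\<in>half_open t0 \<tau>0. y t < \<eta> t)))"
proof -
  let ?J = "half_open t0 \<tau>0"
  note cont = assms(2-9)
  have y1: "cubic_ode_solution a1 b1 c1 d1 ?J y1" and \<eta>: "cubic_supersolution a b c d ?J \<eta>"
    using assms(10,11) .
  note on_Icc = continuous_on_subset[OF _ Icc_subset_half_open]
  have lower: "y1 t \<le> y t" "y1 t0 < y t0 \<Longrightarrow> y1 t < y t"
    if t: "t \<in> ?J" and y: "cubic_supersolution a b c d {t0..t} y" and init: "\<gamma> \<le> y t0" for t y
  proof -
    have sub: "{t0..t} \<subseteq> ?J" by (rule Icc_subset_half_open[OF t])
    \<comment> \<open>Local integrability speaks of nondegenerate intervals only; a larger \<open>T\<close> covers \<open>t = t0\<close>.\<close>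
    obtain T where T: "t < T" "T \<in> ?J" using half_open_larger[OF t] .
    have neg: "AE x \<in> {t0..t} in lebesgue. a x < 0"
      using assms(13)
    proof (rule eventually_mono)
      fix x assume "x \<in> ?J \<longrightarrow> a x < 0"
      then show "x \<in> {t0..t} \<longrightarrow> a x < 0" using sub by (meson subsetD)
    qed
    have "set_integrable lebesgue {t0..T} (\<lambda>t. (b t)\<^sup>2 / a t)"
      using assms(14) T t unfolding locally_integrable_on_def by (auto simp: half_open_def)
    then have int: "set_integrable lebesgue {t0..t} (\<lambda>t. (b t)\<^sup>2 / a t)"
      by (rule set_integrable_subset) (use T in auto)
    have tt: "t \<in> {t0..t}" using t by (simp add: half_open_def)
    note comparison = cubic_lower_comparison[OF cont[THEN on_Icc[OF _ t]]
        cubic_ode_solution_subset[OF y1 sub] y neg int _ init tt]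
    show "y1 t \<le> y t" "y1 t0 < y t0 \<Longrightarrow> y1 t < y t"
      using comparison assms(16) sub by blast+
  qed
  have upper: "y t0 \<le> \<eta> t0 \<Longrightarrow> y t \<le> \<eta> t" "y t0 < \<eta> t0 \<Longrightarrow> y t < \<eta> t"
    if t: "t \<in> ?J" and y: "cubic_ode_solution a b c d {t0..t} y" for t y
    using cubic_supersolution_ge_solution[OF cont(1-3)[THEN on_Icc[OF _ t]] y
        cubic_supersolution_subset[OF \<eta> Icc_subset_half_open[OF t]]] t
    by (auto simp: half_open_def)
  show ?thesis
  proof (intro ballI conjI)
    fix y0 assume y0: "y0 \<in> {\<gamma>..\<eta> t0}"
    show "cubic_ivp_exists_on a b c d t0 \<tau>0 y0"
    proof (rule cubic_ivp_exists_on_if_Icc[OF cont(1-3) _ assms(1)])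
      fix T assume T: "T \<in> ?J"
      have "continuous_on {t0..T} (\<lambda>t. \<bar>y1 t\<bar> + \<bar>\<eta> t\<bar>)"
        by (intro continuous_intros on_Icc[OF _ T] cubic_supersolution_continuous[OF \<eta>]
            cubic_supersolution_continuous[OF cubic_ode_solution_imp_supersolution[OF y1]])
      then have "bounded ((\<lambda>t. \<bar>y1 t\<bar> + \<bar>\<eta> t\<bar>) ` {t0..T})"
        by (intro compact_imp_bounded compact_continuous_image compact_Icc)
      then obtain M where "\<forall>v\<in>(\<lambda>t. \<bar>y1 t\<bar> + \<bar>\<eta> t\<bar>) ` {t0..T}. norm v < M"
        unfolding bounded_pos_less by blast
      then have M: "\<bar>y1 t\<bar> + \<bar>\<eta> t\<bar> < M" if "t \<in> {t0..T}" for t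
        using that by auto
      show "\<exists>y. cubic_ode_solution a b c d {t0..T} y \<and> y t0 = y0"
      proof (rule cubic_ivp_exists_if_bounded)
        show "t0 \<le> T" using T by (simp add: half_open_def)
        show "\<bar>y0\<bar> < M"
          using M[of t0] y0 assms(15) \<open>t0 \<le> T\<close> by auto
        fix s y assume s: "s \<in> {t0..T}" and y: "cubic_ode_solution a b c d {t0..s} y" "y t0 = y0"
        have "s \<in> ?J" using s Icc_subset_half_open[OF T] by blast
        then have "y1 s \<le> y s" "y s \<le> \<eta> s"
          using lower(1) upper(1) y y0 cubic_ode_solution_imp_supersolution by auto
        then show "\<bar>y s\<bar> < M" using M[OF s] by auto
      qed (use cont(1-4)[THEN on_Icc[OF _ T]] in auto)
    qed
    show "\<forall>y. cubic_ode_solution a b c d ?J y \<and> y t0 = y0 \<longrightarrow>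
      (\<forall>t\<in>?J. y1 t \<le> y t \<and> y t \<le> \<eta> t) \<and>
      (y1 t0 < y t0 \<longrightarrow> (\<forall>t\<in>?J. y1 t < y t)) \<and>
      (y t0 < \<eta> t0 \<longrightarrow> (\<forall>t\<in>?J. y t < \<eta> t))"
    proof (intro allI impI, elim conjE)
      fix y assume y: "cubic_ode_solution a b c d ?J y" and init: "y t0 = y0"
      have sol: "cubic_ode_solution a b c d {t0..t} y" if "t \<in> ?J" for t
        by (rule cubic_ode_solution_subset[OF y Icc_subset_half_open[OF that]])
      note lower' = lower[OF _ cubic_ode_solution_imp_supersolution[OF sol]]
      have "\<gamma> \<le> y t0" "y t0 \<le> \<eta> t0" using init y0 by auto
      then show "(\<forall>t\<in>?J. y1 t \<le> y t \<and> y t \<le> \<eta> t) \<and>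
          (y1 t0 < y t0 \<longrightarrow> (\<forall>t\<in>?J. y1 t < y t)) \<and>
          (y t0 < \<eta> t0 \<longrightarrow> (\<forall>t\<in>?J. y t < \<eta> t))"
        using lower' upper[OF _ sol] by blast
    qed
  qed
qed

end
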